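(* Let $1\le r<k<\infty$ be integers. Suppose $A\in\mathcal{B}(\mathcal{H})$ and $F\in\mathcal{F}_r$. Then $\Lambda_k(A)\subseteq\Lambda_{k-r}(A+F)$. Consequently, $$\Lambda_k(A)\subseteq\bigcap\{\Lambda_{k-r}(A+F): F\in\mathcal{F}_r\}.$$
   Context: $\mathcal{H}$ is a complex Hilbert space with $\dim\mathcal{H}\ge k$ and $\mathcal{B}(\mathcal{H})$ is the algebra of bounded linear operators on $\mathcal{H}$. $\mathcal{F}_r$ is the set of operators in $\mathcal{B}(\mathcal{H})$ of rank at most $r$. For a positive integer $m\le\dim\mathcal{H}$, $\Lambda_m(A)=\{\lambda\in\mathbb{C}: PAP=\lambda P \text{ for some rank-}m\text{ orthogonal projection }P\in\mathcal{B}(\mathcal{H})\}$. *)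

theory Defs
  imports Complex_Main "HOL-Library.Extended_Nat"
begin

text \<open>Complex inner product spaces, with the inner product linear in its first argument. The real
  vector space structure and the norm are the library's; the last axiom makes the norm the one
  induced by the inner product, and hence also contains positive definiteness.\<close>

class complex_inner = real_normed_vector +
  fixes scaleC :: "complex \<Rightarrow> 'a \<Rightarrow> 'a"
    and cinner :: "'a \<Rightarrow> 'a \<Rightarrow> complex"
  assumes scaleC_add_right: "scaleC c (x + y) = scaleC c x + scaleC c y"
    and scaleC_add_left: "scaleC (c + d) x = scaleC c x + scaleC d x"
    and scaleC_scaleC: "scaleC c (scaleC d x) = scaleC (c * d) x"
    and scaleC_of_real: "scaleC (complex_of_real a) x = a *\<^sub>R x"
    and cinner_commute: "cinner x y = cnj (cinner y x)"
    and cinner_add_left: "cinner (x + y) z = cinner x z + cinner y z"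
    and cinner_scaleC_left: "cinner (scaleC c x) y = c * cinner x y"
    and cinner_self: "cinner x x = complex_of_real ((norm x)\<^sup>2)"

class complex_hilbert = complex_inner + complete_space

global_interpretation complex_vector:
  vector_space "scaleC :: complex \<Rightarrow> 'a \<Rightarrow> 'a::complex_inner"
  defines cspan = complex_vector.span
    and cdependent = complex_vector.dependent
    and cdim = complex_vector.dim
  using scaleC_of_real[of 1]
  by unfold_locales (simp_all add: scaleC_add_right scaleC_add_left scaleC_scaleC)

text \<open>The library's \<open>dim\<close> is a natural number and carries no information for subspaces without a
  finite basis, so those get dimension \<open>\<infinity>\<close> explicitly. Infinite
  cardinals need not be distinguished.\<close>

definition ecdim :: "'a::complex_inner set \<Rightarrow> enat" where
  "ecdim S = (if \<exists>B. finite B \<and> S \<subseteq> cspan B then enat (cdim S) else \<infinity>)"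

definition bounded_operators :: "('a::complex_inner \<Rightarrow> 'a) set" where
  "bounded_operators = {T. bounded_linear T \<and> (\<forall>c x. T (scaleC c x) = scaleC c (T x))}"

definition op_rank :: "('a::complex_inner \<Rightarrow> 'a) \<Rightarrow> enat" where
  "op_rank T = ecdim (range T)"

definition rank_at_most :: "nat \<Rightarrow> ('a::complex_inner \<Rightarrow> 'a) set" where
  "rank_at_most r = {F \<in> bounded_operators. op_rank F \<le> enat r}"

definition orthogonal_projection :: "('a::complex_inner \<Rightarrow> 'a) \<Rightarrow> bool" where
  "orthogonal_projection P \<longleftrightarrow>
     P \<in> bounded_operators \<and> (\<forall>x. P (P x) = P x) \<and> (\<forall>x y. cinner (P x) y = cinner x (P y))"

definition rank_numerical_range :: "nat \<Rightarrow> ('a::complex_inner \<Rightarrow> 'a) \<Rightarrow> complex set" where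
  "rank_numerical_range m A =
     {l. \<exists>P. orthogonal_projection P \<and> op_rank P = enat m \<and> (\<forall>x. P (A (P x)) = scaleC l (P x))}"

end

theory Submission
  imports Defs
begin

text \<open>A point \<open>\<lambda>\<close> lies in the rank-\<open>k\<close> numerical range of \<open>A\<close> when \<open>A\<close> compresses to the scalar
  \<open>\<lambda>\<close> on some \<open>k\<close>-dimensional subspace \<open>V\<close>, and this property is inherited by every subspace of
  \<open>V\<close>. On the part \<open>W\<close> of \<open>V\<close> that \<open>F\<close> annihilates, \<open>A\<close> and \<open>A + F\<close> agree, so \<open>A + F\<close> also
  compresses to \<open>\<lambda>\<close> there. By rank-nullity \<open>dim W \<ge> k - r\<close>, so that \<open>W\<close> has an orthonormal
  family of \<open>k - r\<close> vectors, and the projection onto its span is the required witness.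

  The family is grown one vector at a time. It can be extended as long as it does not span \<open>W\<close>
  (lemma \<open>orthonormal_extend\<close>), and a spanning family of \<open>W\<close> has at least \<open>k - r\<close> members because
  \<open>V\<close> is spanned by it together with preimages of a basis of \<open>F(V)\<close>
  (lemma \<open>cdim_le_kernel_plus_rank\<close>). The explicit formula \<open>x \<mapsto> \<Sum>e. \<langle>x, e\<rangle> e\<close> then gives the
  projection (lemma \<open>orthogonal_projection_oproj\<close>).\<close>

section \<open>The inner product\<close>

lemma cinner_add_right: "cinner x (y + z) = cinner x y + cinner x (z :: 'a::complex_inner)"
  by (metis cinner_add_left cinner_commute complex_cnj_add)

lemma cinner_scaleC_right: "cinner x (scaleC c y) = cnj c * cinner x (y :: 'a::complex_inner)"
  by (metis cinner_commute cinner_scaleC_left complex_cnj_mult)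

lemma cinner_zero_left [simp]: "cinner 0 (y :: 'a::complex_inner) = 0"
  using cinner_add_left[of 0 0 y] by simp

lemma cinner_zero_right [simp]: "cinner (x :: 'a::complex_inner) 0 = 0"
  using cinner_add_right[of x 0 0] by simp

lemma cinner_diff_left: "cinner (x - y) z = cinner x z - cinner y (z :: 'a::complex_inner)"
  using cinner_add_left[of "x - y" y z] by simp

lemma cinner_sum_left: "cinner (\<Sum>i\<in>I. f i) (y :: 'a::complex_inner) = (\<Sum>i\<in>I. cinner (f i) y)"
  by (induction I rule: infinite_finite_induct) (auto simp: cinner_add_left)

lemma cinner_sum_right: "cinner (x :: 'a::complex_inner) (\<Sum>i\<in>I. f i) = (\<Sum>i\<in>I. cinner x (f i))"
  by (induction I rule: infinite_finite_induct) (auto simp: cinner_add_right)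

lemma bounded_operators_linear:
  assumes "T \<in> bounded_operators"
  shows "T (x + y) = T x + T y" "T (x - y) = T x - T y" "T 0 = 0" "T (scaleC c x) = scaleC c (T x)"
proof -
  interpret bounded_linear T
    using assms by (simp add: bounded_operators_def)
  show "T (x + y) = T x + T y" "T (x - y) = T x - T y" "T 0 = 0"
    by (rule add diff zero)+
  show "T (scaleC c x) = scaleC c (T x)"
    using assms by (simp add: bounded_operators_def)
qed

section \<open>Orthonormal sets and their projections\<close>

definition orthonormal :: "'a::complex_inner set \<Rightarrow> bool" where
  "orthonormal E \<longleftrightarrow> (\<forall>e\<in>E. \<forall>f\<in>E. cinner e f = (if e = f then 1 else 0))"

definition oproj :: "'a::complex_inner set \<Rightarrow> 'a \<Rightarrow> 'a" where
  "oproj E x = (\<Sum>e\<in>E. scaleC (cinner x e) e)"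

lemma oproj_in_cspan: "oproj E x \<in> cspan E"
  unfolding oproj_def
  by (intro complex_vector.span_sum complex_vector.span_scale complex_vector.span_base)

lemma oproj_add: "oproj E (x + y) = oproj E x + oproj E y"
  by (simp add: oproj_def cinner_add_left scaleC_add_left sum.distrib)

lemma oproj_scaleC: "oproj E (scaleC c x) = scaleC c (oproj E x)"
  by (simp add: oproj_def cinner_scaleC_left complex_vector.scale_sum_right)

lemma cinner_oproj_basis:
  assumes "finite E" "orthonormal E" "f \<in> E"
  shows "cinner (oproj E x) f = cinner x f"
proof -
  have "cinner (oproj E x) f = (\<Sum>e\<in>E. if e = f then cinner x e else 0)"
    unfolding oproj_def cinner_sum_left cinner_scaleC_left
    using assms(2,3) by (intro sum.cong) (auto simp: orthonormal_def)
  then show ?thesis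
    using assms(1,3) by simp
qed

lemma oproj_self_adjoint: "cinner (oproj E x) y = cinner x (oproj E y)"
  unfolding oproj_def cinner_sum_left cinner_sum_right cinner_scaleC_left cinner_scaleC_right
  by (simp add: cinner_commute[of _ y] mult.commute)

lemma oproj_on_cspan:
  assumes "finite E" "orthonormal E" "x \<in> cspan E"
  shows "oproj E x = x"
proof -
  have "oproj E e = e" if "e \<in> E" for e
  proof -
    have "oproj E e = (\<Sum>f\<in>E. if f = e then f else 0)"
      unfolding oproj_def using assms(2) that by (intro sum.cong) (auto simp: orthonormal_def)
    then show ?thesis
      using assms(1) that by simp
  qed
  moreover have "complex_vector.subspace {x. oproj E x = x}"
    unfolding complex_vector.subspace_def
    by (auto simp: oproj_add oproj_scaleC) (simp add: oproj_def)
  ultimately have "cspan E \<subseteq> {x. oproj E x = x}"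
    by (intro complex_vector.span_minimal) auto
  then show ?thesis
    using assms(3) by auto
qed

text \<open>A member in the span of the others would be its own projection onto that span, but it is
  orthogonal to all of them, so this projection is \<open>0\<close>.\<close>

lemma orthonormal_independent:
  assumes "finite E" "orthonormal E"
  shows "\<not> cdependent E"
proof
  assume "cdependent E"
  then obtain a where a: "a \<in> E" "a \<in> cspan (E - {a})"
    unfolding complex_vector.dependent_def by auto
  have "orthonormal (E - {a})"
    using assms(2) by (auto simp: orthonormal_def)
  then have "oproj (E - {a}) a = a"
    using assms(1) a(2) by (intro oproj_on_cspan) auto
  moreover have "oproj (E - {a}) a = 0"
    unfolding oproj_def using assms(2) a(1) by (intro sum.neutral) (auto simp: orthonormal_def)
  ultimately have "cinner a a = 0"
    by simp
  then show False
    using assms(2) a(1) by (auto simp: orthonormal_def)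
qed

text \<open>Boundedness comes from Pythagoras: \<open>x\<close> is the orthogonal sum of its projection and the
  remainder, hence the projection is no longer than \<open>x\<close>.\<close>

lemma norm_oproj_le:
  assumes "finite E" "orthonormal E"
  shows "norm (oproj E x) \<le> norm x"
proof -
  define p q where "p = oproj E x" and "q = x - oproj E x"
  have pp: "oproj E p = p"
    unfolding p_def using assms oproj_in_cspan by (rule oproj_on_cspan)
  have "oproj E q + p = oproj E (q + p)"
    by (simp add: oproj_add pp)
  also have "\<dots> = p"
    by (simp add: p_def q_def)
  finally have "oproj E q = 0"
    by simp
  then have qp: "cinner q p = 0"
    by (metis pp oproj_self_adjoint cinner_zero_left)
  then have "cinner p q = 0"
    by (metis cinner_commute complex_cnj_zero)
  moreover have "x = p + q"
    by (simp add: p_def q_def)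
  ultimately have "cinner x x = cinner p p + cinner q q"
    using qp by (simp add: cinner_add_left cinner_add_right)
  then have "(norm x)\<^sup>2 = (norm p)\<^sup>2 + (norm q)\<^sup>2"
    unfolding cinner_self by (metis of_real_add of_real_eq_iff)
  then have "(norm p)\<^sup>2 \<le> (norm x)\<^sup>2"
    by simp
  then show ?thesis
    unfolding p_def[symmetric] by (rule power2_le_imp_le) simp
qed

lemma orthogonal_projection_oproj:
  assumes "finite E" "orthonormal E"
  shows "orthogonal_projection (oproj E)"
proof -
  have "bounded_linear (oproj E)"
  proof (rule bounded_linear_intro)
    show "oproj E (r *\<^sub>R x) = r *\<^sub>R oproj E x" for r x
      using oproj_scaleC[of E "complex_of_real r" x] by (simp add: scaleC_of_real)
    show "norm (oproj E x) \<le> norm x * 1" for x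
      using norm_oproj_le[OF assms] by simp
  qed (rule oproj_add)
  then show ?thesis
    unfolding orthogonal_projection_def bounded_operators_def
    using oproj_on_cspan[OF assms oproj_in_cspan]
    by (auto simp: oproj_scaleC oproj_self_adjoint)
qed

lemma op_rank_oproj:
  assumes "finite E" "orthonormal E"
  shows "op_rank (oproj E) = enat (card E)"
proof -
  have "range (oproj E) = cspan E"
    using oproj_in_cspan oproj_on_cspan[OF assms] by (metis rangeI subsetI subset_antisym image_subsetI)
  moreover have "cdim (cspan E) = card E"
    using orthonormal_independent[OF assms]
    by (simp add: complex_vector.dim_span complex_vector.dim_eq_card_independent)
  ultimately show ?thesis
    using assms(1) by (auto simp: op_rank_def ecdim_def)
qed

text \<open>One step of Gram-Schmidt: a vector outside the span, minus its projection, is a new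
  direction.\<close>

lemma orthonormal_extend:
  fixes E :: "'a::complex_inner set"
  assumes fin: "finite E" and orth: "orthonormal E"
    and sub: "E \<subseteq> W" "complex_vector.subspace W" and "\<not> W \<subseteq> cspan E"
  obtains e where "e \<in> W" "e \<notin> E" "orthonormal (insert e E)"
proof -
  obtain w where w: "w \<in> W" "w \<notin> cspan E"
    using assms(5) by auto
  define u where "u = w - oproj E w"
  define e where "e = scaleC (complex_of_real (1 / norm u)) u"
  have "oproj E w \<in> W"
    using oproj_in_cspan complex_vector.span_minimal[OF sub] by blast
  then have "e \<in> W"
    unfolding e_def u_def
    using w(1) sub(2) by (intro complex_vector.subspace_scale complex_vector.subspace_diff)
  have "norm u \<noteq> 0"
    using w(2) oproj_in_cspan[of E w] by (auto simp: u_def)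
  then have ee: "cinner e e = 1"
    unfolding e_def cinner_scaleC_left cinner_scaleC_right cinner_self[of u]
    by (simp add: power2_eq_square)
  have ef: "cinner e f = 0" if "f \<in> E" for f
    using cinner_oproj_basis[OF fin orth that]
    by (simp add: e_def u_def cinner_scaleC_left cinner_diff_left)
  then have fe: "cinner f e = 0" if "f \<in> E" for f
    using that by (metis cinner_commute complex_cnj_zero)
  have "e \<notin> E"
    using ee ef by force
  moreover have "orthonormal (insert e E)"
    using orth ee ef fe by (auto simp: orthonormal_def)
  ultimately show thesis
    using that \<open>e \<in> W\<close> by blast
qed

section \<open>Counting dimensions\<close>

text \<open>The inequality of rank-nullity that is needed here, with the kernel of \<open>F\<close> on \<open>V\<close> covered
  by the span of a given finite set. Subtracting from \<open>v \<in> V\<close> a combination of preimages of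
  basis vectors of \<open>F(V)\<close> leaves a vector of the kernel.\<close>

lemma cdim_le_kernel_plus_rank:
  fixes F :: "'a::complex_inner \<Rightarrow> 'a"
  assumes F: "F \<in> rank_at_most r" and V: "complex_vector.subspace V"
    and fin: "finite E" and ker: "{v \<in> V. F v = 0} \<subseteq> cspan E"
  shows "cdim V \<le> card E + r"
proof -
  have "F \<in> bounded_operators"
    using F by (simp add: rank_at_most_def)
  note lin = bounded_operators_linear[OF this]
  have hom: "module_hom scaleC scaleC F"
    by unfold_locales (simp_all add: lin scaleC_add_right scaleC_add_left scaleC_scaleC)
  obtain B where "finite B" "range F \<subseteq> cspan B" and r: "cdim (range F) \<le> r"
    using F by (auto simp: rank_at_most_def op_rank_def ecdim_def split: if_splits)
  obtain C0 where C0: "C0 \<subseteq> range F" "\<not> cdependent C0" "range F \<subseteq> cspan C0"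
      "card C0 = cdim (range F)"
    using complex_vector.basis_exists by metis
  have "finite C0"
    using complex_vector.independent_span_bound[OF \<open>finite B\<close> C0(2)] C0(1) \<open>range F \<subseteq> cspan B\<close>
    by auto
  obtain C where C: "C \<subseteq> F ` V" "\<not> cdependent C" "F ` V \<subseteq> cspan C"
    using complex_vector.basis_exists by metis
  have "C \<subseteq> cspan C0"
    using C(1) C0(3) by blast
  then have "finite C" "card C \<le> card C0"
    using complex_vector.independent_span_bound[OF \<open>finite C0\<close> C(2)] by auto
  obtain D where D: "D \<subseteq> V" "inj_on F D" "C = F ` D"
    using C(1) by (metis subset_image_inj)
  have "finite D" "card D \<le> r"
    using \<open>finite C\<close> \<open>card C \<le> card C0\<close> C0(4) r D(2,3)
    by (auto simp: card_image finite_image_iff)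
  have "V \<subseteq> cspan (E \<union> D)"
  proof
    fix v assume "v \<in> V"
    then have "F v \<in> F ` cspan D"
      using C(3) D(3) module_hom.span_image[OF hom, folded cspan_def] by auto
    then obtain w where w: "w \<in> cspan D" "F v = F w"
      by auto
    then have "w \<in> V"
      using complex_vector.span_minimal[OF D(1) V] by auto
    then have "v - w \<in> cspan E"
      using ker w(2) \<open>v \<in> V\<close> V by (auto simp: lin complex_vector.subspace_diff)
    then have "(v - w) + w \<in> cspan (E \<union> D)"
      using w(1) complex_vector.span_mono[of E "E \<union> D"] complex_vector.span_mono[of D "E \<union> D"]
      by (intro complex_vector.span_add) auto
    then show "v \<in> cspan (E \<union> D)"
      by simp
  qed
  then have "cdim V \<le> card (E \<union> D)"
    using fin \<open>finite D\<close> by (intro complex_vector.dim_le_card) auto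
  also have "\<dots> \<le> card E + r"
    using card_Un_le[of E D] \<open>card D \<le> r\<close> by linarith
  finally show ?thesis .
qed

text \<open>While fewer than \<open>dim V - r\<close> vectors have been found, they cannot span the kernel of \<open>F\<close>
  on \<open>V\<close>, so Gram-Schmidt inside that kernel does not stop early.\<close>

lemma orthonormal_set_in_kernel:
  fixes F :: "'a::complex_inner \<Rightarrow> 'a"
  assumes F: "F \<in> rank_at_most r" and V: "complex_vector.subspace V"
    and "n + r \<le> cdim V"
  shows "\<exists>E. finite E \<and> orthonormal E \<and> card E = n \<and> E \<subseteq> {v \<in> V. F v = 0}"
  using assms(3)
proof (induction n)
  case 0
  show ?case
    by (rule exI[of _ "{}"]) (simp add: orthonormal_def)
next
  case (Suc n)
  let ?W = "{v \<in> V. F v = 0}"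
  obtain E where E: "finite E" "orthonormal E" "card E = n" "E \<subseteq> ?W"
    using Suc by auto
  have "F \<in> bounded_operators"
    using F by (simp add: rank_at_most_def)
  note lin = bounded_operators_linear[OF this]
  have "complex_vector.subspace ?W"
    using V by (auto simp: complex_vector.subspace_def lin)
  moreover have "\<not> ?W \<subseteq> cspan E"
    using cdim_le_kernel_plus_rank[OF F V E(1)] E(3) Suc.prems by auto
  ultimately obtain e where "e \<in> ?W" "e \<notin> E" "orthonormal (insert e E)"
    using orthonormal_extend[OF E(1,2,4)] by metis
  then show ?case
    using E by (intro exI[of _ "insert e E"]) auto
qed

section \<open>Perturbation of finite rank\<close>

lemma rank_numerical_range_perturb:
  fixes A F :: "'a::complex_inner \<Rightarrow> 'a"
  assumes "r \<le> k" and F: "F \<in> rank_at_most r"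
  shows "rank_numerical_range k A \<subseteq> rank_numerical_range (k - r) (\<lambda>x. A x + F x)"
proof
  fix l assume "l \<in> rank_numerical_range k A"
  then obtain P where P: "orthogonal_projection P" "op_rank P = enat k"
      and comp: "\<And>x. P (A (P x)) = scaleC l (P x)"
    by (auto simp: rank_numerical_range_def)
  have "P \<in> bounded_operators" and "F \<in> bounded_operators"
    and idem: "P (P x) = P x" and adj: "cinner (P x) y = cinner x (P y)" for x y
    using P(1) F by (auto simp: orthogonal_projection_def rank_at_most_def)
  note P_lin = bounded_operators_linear[OF this(1)] and F_lin = bounded_operators_linear[OF this(2)]
  have "range P = {v. P v = v}"
    using idem by (auto intro: range_eqI[OF sym])
  then have "complex_vector.subspace (range P)"
    by (simp add: complex_vector.subspace_def P_lin)
  moreover have "cdim (range P) = k"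
    using P(2) by (auto simp: op_rank_def ecdim_def split: if_splits)
  ultimately obtain E where E: "finite E" "orthonormal E" "card E = k - r"
      "E \<subseteq> {v \<in> range P. F v = 0}"
    using orthonormal_set_in_kernel[OF F, of "range P" "k - r"] assms(1) by auto
  define Q where "Q = oproj E"
  have PQ: "P (Q x) = Q x" and FQ: "F (Q x) = 0" for x
  proof -
    have "complex_vector.subspace {v. P v = v \<and> F v = 0}"
      by (simp add: complex_vector.subspace_def P_lin F_lin)
    moreover have "E \<subseteq> {v. P v = v \<and> F v = 0}"
      using E(4) idem by auto
    ultimately have "cspan E \<subseteq> {v. P v = v \<and> F v = 0}"
      by (intro complex_vector.span_minimal)
    then show "P (Q x) = Q x" "F (Q x) = 0"
      using oproj_in_cspan[of E x] by (auto simp: Q_def)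
  qed
  \<comment> \<open>The adjoint of \<open>P Q = Q\<close>, visible from the coefficients \<open>\<langle>P x, e\<rangle> = \<langle>x, P e\<rangle> = \<langle>x, e\<rangle>\<close>.\<close>
  have QP: "Q (P x) = Q x" for x
    unfolding Q_def oproj_def using E(4) idem by (intro sum.cong) (auto simp: adj)
  have "Q (A (Q x) + F (Q x)) = scaleC l (Q x)" for x
  proof -
    have "Q (A (Q x) + F (Q x)) = Q (P (A (P (Q x))))"
      by (simp add: FQ PQ QP)
    also have "\<dots> = scaleC l (Q (Q x))"
      unfolding comp by (simp add: PQ) (simp add: Q_def oproj_scaleC)
    also have "Q (Q x) = Q x"
      unfolding Q_def by (rule oproj_on_cspan[OF E(1,2) oproj_in_cspan])
    finally show ?thesis .
  qed
  then show "l \<in> rank_numerical_range (k - r) (\<lambda>x. A x + F x)"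
    using orthogonal_projection_oproj[OF E(1,2)] op_rank_oproj[OF E(1,2)] E(3)
    unfolding rank_numerical_range_def Q_def by auto
qed

theorem theorem3p1:
  fixes A :: "'a::complex_hilbert \<Rightarrow> 'a" and r k :: nat
  assumes "1 \<le> r" and "r < k"
    and "enat k \<le> ecdim (UNIV :: 'a set)"
    and "A \<in> bounded_operators"
  shows "(\<forall>F \<in> rank_at_most r. rank_numerical_range k A \<subseteq> rank_numerical_range (k - r) (\<lambda>x. A x + F x)) \<and>
    rank_numerical_range k A \<subseteq> (\<Inter>F \<in> rank_at_most r. rank_numerical_range (k - r) (\<lambda>x. A x + F x))"
  using rank_numerical_range_perturb[OF less_imp_le[OF assms(2)]] by blast

end
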